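(* Let $F=\{f_i\}_{i=1}^k\subseteq\mathcal{H}^n\setminus\{0\}$ be a tight frame for $\mathcal{H}^n$ with frame operator $S_F$. Then $F$ and its canonical dual frame $\widetilde F=\{S_F^{-1}f_i\}_{i=1}^k$ have the same factor posets, i.e. $\mathbb{F}_F=\mathbb{F}_{\widetilde F}$.
   Context: $\mathcal{H}^n$ denotes $\mathbb{R}^n$ or $\mathbb{C}^n$. A finite sequence $\{f_i\}_{i\in I}$ of vectors (repetitions allowed) in $\mathcal{H}^n$ is a frame for $\mathcal{H}^n$ if there are constants $A,B>0$ with $A\|f\|^2\le\sum_{i\in I}|\langle f,f_i\rangle|^2\le B\|f\|^2$ for all $f\in\mathcal{H}^n$. It is a tight frame if one can take $A=B$. The frame operator is $S_F x=\sum_{i}\langle x,f_i\rangle f_i$, which is invertible when $F$ is a frame. The factor poset $\mathbb{F}_F$ of a finite frame $F=\{f_i\}_{i\in I}$ of nonzero vectors is the collection of subsets of $I$, ordered by inclusion, such that $\emptyset\in\mathbb{F}_F$ and a non-empty $J\subseteq I$ belongs to $\mathbb{F}_F$ if and only if $\{f_j\}_{j\in J}$ is a tight frame for $\mathcal{H}^n$. *)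

theory Defs
  imports "HOL-Analysis.Analysis"
begin

text \<open>
  The notions below take the inner product \<open>ip\<close> as a parameter, so that they apply both to
  \<open>real ^ 'n\<close>, with the library inner product \<open>inner\<close>, and to \<open>complex ^ 'n\<close>, with
  \<open>hermitian_inner\<close>. (The library \<open>inner\<close> on \<open>complex ^ 'n\<close> is only the real part of
  the latter.) In both cases \<open>norm\<close> is the norm induced by \<open>ip\<close>.
\<close>

definition hermitian_inner :: "complex ^ 'n \<Rightarrow> complex ^ 'n \<Rightarrow> complex" where
  "hermitian_inner x y = (\<Sum>i\<in>UNIV. x $ i * cnj (y $ i))"

definition frame_bounds ::
  "('a::real_normed_field ^ 'n \<Rightarrow> 'a ^ 'n \<Rightarrow> 'a) \<Rightarrow> real \<Rightarrow> real \<Rightarrow> 'i set \<Rightarrow> ('i \<Rightarrow> 'a ^ 'n) \<Rightarrow> bool"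
where
  "frame_bounds ip A B I F \<longleftrightarrow>
     A > 0 \<and> B > 0 \<and>
     (\<forall>x. A * (norm x)\<^sup>2 \<le> (\<Sum>i\<in>I. (norm (ip x (F i)))\<^sup>2) \<and>
          (\<Sum>i\<in>I. (norm (ip x (F i)))\<^sup>2) \<le> B * (norm x)\<^sup>2)"

definition is_frame ::
  "('a::real_normed_field ^ 'n \<Rightarrow> 'a ^ 'n \<Rightarrow> 'a) \<Rightarrow> 'i set \<Rightarrow> ('i \<Rightarrow> 'a ^ 'n) \<Rightarrow> bool"
where
  "is_frame ip I F \<longleftrightarrow> finite I \<and> (\<exists>A B. frame_bounds ip A B I F)"

definition is_tight_frame ::
  "('a::real_normed_field ^ 'n \<Rightarrow> 'a ^ 'n \<Rightarrow> 'a) \<Rightarrow> 'i set \<Rightarrow> ('i \<Rightarrow> 'a ^ 'n) \<Rightarrow> bool"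
where
  "is_tight_frame ip I F \<longleftrightarrow> is_frame ip I F \<and> (\<exists>A. frame_bounds ip A A I F)"

definition frame_operator ::
  "('a::real_normed_field ^ 'n \<Rightarrow> 'a ^ 'n \<Rightarrow> 'a) \<Rightarrow> 'i set \<Rightarrow> ('i \<Rightarrow> 'a ^ 'n) \<Rightarrow> 'a ^ 'n \<Rightarrow> 'a ^ 'n"
where
  "frame_operator ip I F x = (\<Sum>i\<in>I. ip x (F i) *s F i)"

text \<open>
  The inverse is meaningful when \<open>F\<close> is a frame, since then the frame operator is bijective.
\<close>

definition canonical_dual ::
  "('a::real_normed_field ^ 'n \<Rightarrow> 'a ^ 'n \<Rightarrow> 'a) \<Rightarrow> 'i set \<Rightarrow> ('i \<Rightarrow> 'a ^ 'n) \<Rightarrow> 'i \<Rightarrow> 'a ^ 'n"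
where
  "canonical_dual ip I F i = inv (frame_operator ip I F) (F i)"

text \<open>
  The order on a factor poset is always inclusion, so it is determined by its underlying
  collection of index sets, and equality of factor posets is equality of these collections.
\<close>

definition factor_poset ::
  "('a::real_normed_field ^ 'n \<Rightarrow> 'a ^ 'n \<Rightarrow> 'a) \<Rightarrow> 'i set \<Rightarrow> ('i \<Rightarrow> 'a ^ 'n) \<Rightarrow> 'i set set"
where
  "factor_poset ip I F = {J. J \<subseteq> I \<and> (J = {} \<or> is_tight_frame ip J F)}"

end

theory Submission
  imports Defs
begin

text \<open>
  Tightness with bound \<open>A\<close> says that the self-adjoint operator \<open>S - A\<close> has vanishing quadratic
  form, so it is zero and \<open>S = A\<close>. The canonical dual is therefore the rescaling of \<open>F\<close> by
  \<open>1 / A\<close>, and rescaling all vectors by one nonzero scalar does not affect which subfamilies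
  are tight.
\<close>

text \<open>Treats the real and the complex case at once: \<open>conj\<close> is the identity over
  the reals and \<open>cnj\<close> over the complex numbers. The axiom \<open>self\<close> ties
  \<open>ip\<close> to the norm used in \<open>frame_bounds\<close>.\<close>

locale scalar_product =
  fixes ip :: "'a::real_normed_field ^ 'n \<Rightarrow> 'a ^ 'n \<Rightarrow> 'a"
    and conj :: "'a \<Rightarrow> 'a"
  assumes add_left: "ip (x + y) z = ip x z + ip y z"
    and scale_left: "ip (c *s x) y = c * ip x y"
    and commute: "ip y x = conj (ip x y)"
    and self: "ip x x = of_real ((norm x)\<^sup>2)"
    and conj_add: "conj (a + b) = conj a + conj b"
    and conj_mult: "conj (a * b) = conj a * conj b"
    and mult_conj: "a * conj a = of_real ((norm a)\<^sup>2)"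
    and norm_conj: "norm (conj a) = norm a"
    and conj_of_real: "conj (of_real r) = of_real r"
begin

lemma add_right: "ip x (y + z) = ip x y + ip x z"
  by (metis add_left commute conj_add)

lemma scale_right: "ip x (c *s y) = conj c * ip x y"
  by (metis commute conj_mult scale_left)

lemma zero_left: "ip 0 y = 0"
  using scale_left[of 0 0 y] by simp

lemma sum_left: "ip (\<Sum>i\<in>I. f i) y = (\<Sum>i\<in>I. ip (f i) y)"
  by (induction I rule: infinite_finite_induct) (simp_all add: zero_left add_left)

lemma sum_right: "ip y (\<Sum>i\<in>I. f i) = (\<Sum>i\<in>I. ip y (f i))"
proof -
  have "ip y 0 = 0"
    using add_right[of y 0 0] by simp
  then show ?thesis
    by (induction I rule: infinite_finite_induct) (simp_all add: add_right)
qed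

lemma diff_left: "ip (x - y) z = ip x z - ip y z"
  using add_left[of "x - y" y z] by simp

lemma diff_right: "ip z (x - y) = ip z x - ip z y"
  using add_right[of z "x - y" y] by simp

text \<open>Over the reals a vanishing quadratic form alone does not force T = 0 (a quarter turn of
  the plane has one); self-adjointness makes the cross terms add up instead of cancelling.\<close>

lemma self_adjoint_zero_form:
  assumes add: "\<And>x y. T (x + y) = T x + T y"
    and adjoint: "\<And>x y. ip (T x) y = ip x (T y)"
    and form: "\<And>x. ip (T x) x = 0"
  shows "T x = 0"
proof -
  \<comment> \<open>Polarization with the test vector \<open>x + T x\<close>: the two diagonal terms
    vanish by \<open>form\<close>, and \<open>adjoint\<close> turns each cross term into the squared
    norm of \<open>T x\<close>.\<close>
  have "0 = ip (T (x + T x)) (x + T x)"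
    by (simp add: form)
  also have "\<dots> = ip (T x) (T x) + ip (T (T x)) x"
    by (simp add: add add_left add_right form)
  also have "\<dots> = 2 * of_real ((norm (T x))\<^sup>2)"
    by (simp add: adjoint[of "T x" x] self)
  finally show ?thesis
    by simp
qed

lemma frame_operator_add:
  "frame_operator ip I F (x + y) = frame_operator ip I F x + frame_operator ip I F y"
  by (simp add: frame_operator_def add_left vector_sadd_rdistrib sum.distrib)

lemma frame_operator_adjoint:
  "ip (frame_operator ip I F x) y = ip x (frame_operator ip I F y)"
proof -
  \<comment> \<open>Expanding both sides of the claim gives sums over \<open>I\<close>; this matches
    them term by term.\<close>
  have "ip x (F i) * ip (F i) y = conj (ip y (F i)) * ip x (F i)" for i
    using commute[of "F i" y] by (simp add: mult.commute)
  then show ?thesis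
    by (simp only: frame_operator_def sum_left sum_right scale_left scale_right)
qed

text \<open>Links the operator to the frame inequality: its quadratic form is the sum bounded in
  \<open>frame_bounds\<close>.\<close>

lemma frame_operator_form:
  "ip (frame_operator ip I F x) x = of_real (\<Sum>i\<in>I. (norm (ip x (F i)))\<^sup>2)"
proof -
  have "ip x (F i) * ip (F i) x = of_real ((norm (ip x (F i)))\<^sup>2)" for i
    by (metis commute mult_conj)
  then show ?thesis
    by (simp add: frame_operator_def sum_left scale_left)
qed

lemma frame_operator_tight:
  assumes "frame_bounds ip A A I F"
  shows "frame_operator ip I F x = of_real A *s x"
proof -
  have tight: "(\<Sum>i\<in>I. (norm (ip x (F i)))\<^sup>2) = A * (norm x)\<^sup>2" for x
    using assms by (auto simp: frame_bounds_def intro: order.antisym)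
  have "frame_operator ip I F x - of_real A *s x = 0"
  proof (rule self_adjoint_zero_form[where T = "\<lambda>x. frame_operator ip I F x - of_real A *s x"])
    fix x y
    show "frame_operator ip I F (x + y) - of_real A *s (x + y) =
        frame_operator ip I F x - of_real A *s x + (frame_operator ip I F y - of_real A *s y)"
      by (simp add: frame_operator_add vector_add_ldistrib algebra_simps)
    show "ip (frame_operator ip I F x - of_real A *s x) y =
        ip x (frame_operator ip I F y - of_real A *s y)"
      by (simp add: diff_left diff_right scale_left scale_right conj_of_real
          frame_operator_adjoint)
    show "ip (frame_operator ip I F x - of_real A *s x) x = 0"
      unfolding diff_left frame_operator_form tight scale_left self by simp
  qed
  then show ?thesis
    by simp
qed

lemma canonical_dual_tight:
  assumes "frame_bounds ip A A I F"
  shows "canonical_dual ip I F i = of_real (1 / A) *s F i"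
proof -
  have "A > 0"
    using assms by (simp add: frame_bounds_def)
  \<comment> \<open>Since \<open>A\<close> is nonzero, multiplication by \<open>1 / A\<close> is a
    two-sided inverse of multiplication by \<open>A\<close>.\<close>
  then have "inv (frame_operator ip I F) = (\<lambda>x. of_real (1 / A) *s x)"
    by (intro inv_unique_comp)
      (auto simp: fun_eq_iff frame_operator_tight[OF assms] vector_smult_assoc)
  then show ?thesis
    by (simp add: canonical_dual_def)
qed

text \<open>Each coefficient \<open>ip x (F i)\<close> is multiplied by \<open>conj c\<close>, of
  the same modulus as \<open>c\<close>. Both bounds get the same factor, so equal bounds stay
  equal.\<close>

lemma frame_bounds_scale:
  assumes "c \<noteq> 0" and "frame_bounds ip A B J F"
  shows "frame_bounds ip ((norm c)\<^sup>2 * A) ((norm c)\<^sup>2 * B) J (\<lambda>i. c *s F i)"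
proof -
  have "(\<Sum>i\<in>J. (norm (ip x (c *s F i)))\<^sup>2) = (norm c)\<^sup>2 * (\<Sum>i\<in>J. (norm (ip x (F i)))\<^sup>2)" for x
    by (simp add: scale_right norm_mult norm_conj power_mult_distrib sum_distrib_left)
  then show ?thesis
    using assms by (simp add: frame_bounds_def mult.assoc)
qed

lemma is_tight_frame_scale:
  assumes "c \<noteq> 0" and "is_tight_frame ip J F"
  shows "is_tight_frame ip J (\<lambda>i. c *s F i)"
  using assms(2) frame_bounds_scale[OF assms(1)]
  unfolding is_tight_frame_def is_frame_def by blast

text \<open>The converse direction rescales by \<open>inverse c\<close>.\<close>

lemma is_tight_frame_scale_iff:
  assumes "c \<noteq> 0"
  shows "is_tight_frame ip J (\<lambda>i. c *s F i) \<longleftrightarrow> is_tight_frame ip J F"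
  using is_tight_frame_scale[OF assms, of J F]
    is_tight_frame_scale[of "inverse c" J "\<lambda>i. c *s F i"] assms
  by (auto simp: vector_smult_assoc)

text \<open>The scalar \<open>1 / A\<close> comes from the whole family and serves every
  \<open>J\<close>, whatever tight bound the subfamily on \<open>J\<close> may have.\<close>

lemma factor_poset_canonical_dual:
  assumes "is_tight_frame ip I F"
  shows "factor_poset ip I (canonical_dual ip I F) = factor_poset ip I F"
proof -
  obtain A where A: "frame_bounds ip A A I F"
    using assms by (auto simp: is_tight_frame_def)
  then have "of_real (1 / A) \<noteq> (0::'a)"
    by (simp add: frame_bounds_def)
  moreover have "canonical_dual ip I F = (\<lambda>i. of_real (1 / A) *s F i)"
    using canonical_dual_tight[OF A] by blast
  ultimately show ?thesis
    by (simp add: factor_poset_def is_tight_frame_scale_iff del: of_real_divide)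
qed

end

lemma scalar_product_inner: "scalar_product (inner :: real ^ 'n \<Rightarrow> _) (\<lambda>a. a)"
proof unfold_locales
  fix x y :: "real ^ 'n"
  show "y \<bullet> x = x \<bullet> y"
    by (rule inner_commute)
qed (simp_all add: inner_add_left scalar_mult_eq_scaleR power2_norm_eq_inner
    flip: power2_eq_square)

text \<open>The norm of \<open>complex ^ 'n\<close> is the Euclidean norm of the moduli of the
  entries, and z times \<open>cnj\<close> z is the squared modulus of z.\<close>

lemma hermitian_inner_self: "hermitian_inner x x = of_real ((norm x)\<^sup>2)"
  by (simp add: hermitian_inner_def norm_vec_def L2_set_def sum_nonneg complex_norm_square
      flip: of_real_power)

lemma scalar_product_hermitian_inner:
  "scalar_product (hermitian_inner :: complex ^ 'n \<Rightarrow> _) cnj"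
proof unfold_locales
  fix x y z :: "complex ^ 'n" and c a :: complex
  show "hermitian_inner (x + y) z = hermitian_inner x z + hermitian_inner y z"
    by (simp add: hermitian_inner_def distrib_right sum.distrib)
  show "hermitian_inner (c *s x) y = c * hermitian_inner x y"
    by (simp add: hermitian_inner_def sum_distrib_left mult.assoc)
  show "hermitian_inner y x = cnj (hermitian_inner x y)"
    by (simp add: hermitian_inner_def mult.commute)
  show "hermitian_inner x x = of_real ((norm x)\<^sup>2)"
    by (rule hermitian_inner_self)
  show "a * cnj a = of_real ((norm a)\<^sup>2)"
    by (simp only: complex_norm_square)
qed simp_all

theorem theorem4p2:
  fixes k :: nat
  shows
    "(\<forall>F :: nat \<Rightarrow> real ^ 'n.
        (\<forall>i\<in>{1..k}. F i \<noteq> 0) \<longrightarrow> is_tight_frame inner {1..k} F \<longrightarrow>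
        factor_poset inner {1..k} F =
        factor_poset inner {1..k} (canonical_dual inner {1..k} F)) \<and>
     (\<forall>F :: nat \<Rightarrow> complex ^ 'n.
        (\<forall>i\<in>{1..k}. F i \<noteq> 0) \<longrightarrow> is_tight_frame hermitian_inner {1..k} F \<longrightarrow>
        factor_poset hermitian_inner {1..k} F =
        factor_poset hermitian_inner {1..k} (canonical_dual hermitian_inner {1..k} F))"
  using scalar_product.factor_poset_canonical_dual[OF scalar_product_inner]
    scalar_product.factor_poset_canonical_dual[OF scalar_product_hermitian_inner]
  by metis

end
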